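(* Let $\sigma:[1,+\infty)\to(0,+\infty)$ be an arbitrary positive continuous function with $\sigma(t)\to0$ as $t\to\infty$, and let $$\psi(R)=\exp\Big\{\int_1^R\frac{\sigma(t)}{t}\,dt\Big\},\qquad R\ge1.$$ Define $r_0=2$, $r_{k+1}=r_k\psi(r_k)$ for $k\in\mathbb{N}\cup\{0\}$, and $$u_\psi(z)=\frac12\sum_{k=1}^{+\infty}\log\Big|1-\frac{z}{r_k}\Big|,\qquad z\in\mathbb{C}.$$ Then there exist no entire function $f$ and constant $\alpha\in[0,1)$ for which $$\int_{|z|<R}\big|u_\psi(z)-\log|f(z)|-\alpha\log|z|\big|\,dm(z)=o\big(R^2\log\psi(R)\big),\qquad R\to\infty.$$
   Context: $m$ denotes plane Lebesgue measure. *)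

theory Defs
  imports "HOL-Complex_Analysis.Complex_Analysis"
begin

definition psi :: "(real \<Rightarrow> real) \<Rightarrow> real \<Rightarrow> real" where
  "psi \<sigma> R = exp (integral {1..R} (\<lambda>t. \<sigma> t / t))"

primrec radius :: "(real \<Rightarrow> real) \<Rightarrow> nat \<Rightarrow> real" where
  "radius \<sigma> 0 = 2"
| "radius \<sigma> (Suc k) = radius \<sigma> k * psi \<sigma> (radius \<sigma> k)"

(* The sum starts at radius \<sigma> 1, hence the index Suc k. At the points radius \<sigma> (Suc k) the
   function is really -\<infinity>, whereas ln 0 = 0 here; these points form a Lebesgue null set. *)
definition u_psi :: "(real \<Rightarrow> real) \<Rightarrow> complex \<Rightarrow> real" where
  "u_psi \<sigma> z = 1/2 * (\<Sum>k. ln (cmod (1 - z / of_real (radius \<sigma> (Suc k)))))"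

(* The L1 deviation over the open disc |z| < R, as an extended nonnegative integral, so that it is
   \<infinity>, and not 0, should the integrand fail to be integrable. Provided that f is not identically
   zero, ln differs from the extended-valued logarithm only on a null set. *)
definition deviation :: "(real \<Rightarrow> real) \<Rightarrow> (complex \<Rightarrow> complex) \<Rightarrow> real \<Rightarrow> real \<Rightarrow> ennreal" where
  "deviation \<sigma> f \<alpha> R =
     (\<integral>\<^sup>+z\<in>ball 0 R. ennreal \<bar>u_psi \<sigma> z - ln (cmod (f z)) - \<alpha> * ln (cmod z)\<bar> \<partial>lborel)"

end

theory Submission
  imports Defs
begin

text \<open>
The obstruction is that \<open>u_psi\<close> carries masses \<open>1/2\<close> at the points \<open>r\<^sub>k\<close>, while \<open>ln \<bar>f\<bar>\<close> only
carries integer masses. It becomes visible after averaging over circles. Suppose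
\<open>v = u_psi - ln \<bar>f\<bar> - \<alpha> ln \<bar>z\<bar>\<close> has small deviation, and let \<open>M r\<close> be the mean of \<open>v\<close> over
\<open>\<bar>z\<bar> = r\<close>. By Jensen's formula, \<open>M\<close> is a piecewise linear function of \<open>ln r\<close>, and between \<open>r\<^sub>k\<close> and
\<open>r\<^sub>k\<^sub>+\<^sub>1\<close> its slope is \<open>k/2 - \<alpha> - n r\<close>, where \<open>n r\<close> is the number of zeros of \<open>f\<close> in \<open>\<bar>z\<bar> < r\<close>, with multiplicity
(\<open>has_circle_mean_ln_entire\<close>, \<open>has_circle_mean_u_psi\<close>). For one parity of \<open>k\<close> the number \<open>k/2 - \<alpha>\<close>
stays at distance at least \<open>1/4\<close> from every integer
(\<open>exists_half_integer_far_from_integers\<close>). As \<open>n\<close> is increasing, the slope is then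
at least \<open>1/4\<close> to the left of any given radius of the annulus or at most \<open>-1/4\<close> to the right of it, so
that \<open>M\<close> cannot be small at three radii far apart from one another (\<open>log_drift\<close>).

The annulus has logarithmic width \<open>L = ln (psi \<sigma> r\<^sub>k)\<close>, which is what makes \<open>ln (psi \<sigma> R)\<close> the critical
rate: the drift of \<open>M\<close> is comparable to \<open>L\<close>, and because \<open>\<sigma>\<close> tends to \<open>0\<close>, \<open>ln (psi \<sigma> R)\<close> is at most
\<open>2 * L\<close> in the whole annulus once \<open>k\<close> is large. On the other hand
the mass of \<open>v\<close> on a thin annulus dominates that of the mean
\<open>M\<close> (\<open>circle_mean_lower_bound_imp_L1_lower_bound\<close>), so a deviation of size \<open>\<epsilon> R\<^sup>2 ln (psi \<sigma> R)\<close> with small \<open>\<epsilon>\<close> forces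
\<open>\<bar>M r\<bar> < L/40\<close> for some \<open>r\<close> slightly below \<open>R\<close>. Taking \<open>R\<close> near the beginning, in the middle and at
the end of the annulus, on a logarithmic scale, gives three radii that contradict the drift.
\<close>

section \<open>Rotation invariance of plane Lebesgue measure\<close>

text \<open>
Lebesgue measure is characterised by its values on boxes, and the preimage of a box under an orthogonal
map has the volume of the box.
\<close>
lemma lborel_distr_orthogonal:
  fixes f :: "real^'n::{finite,wellorder} \<Rightarrow> real^'n::_"
  assumes f: "orthogonal_transformation f"
  shows "distr lborel borel f = lborel"
proof (rule sym, rule lborel_eqI)
  have lin: "linear f" using f by (rule orthogonal_transformation_linear)
  have meas: "f \<in> borel_measurable borel"
    by (intro borel_measurable_continuous_onI linear_continuous_on)
       (use lin linear_conv_bounded_linear in blast)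
  fix l u :: "real^'n::_" assume le: "\<And>b. b \<in> Basis \<Longrightarrow> l \<bullet> b \<le> u \<bullet> b"
  define g where "g = inv f"
  have g: "orthogonal_transformation g"
    unfolding g_def using f by (rule orthogonal_transformation_inv)
  have bij: "bij f" using f by (rule orthogonal_transformation_bij)
  have vim: "f -` box l u = g ` box l u"
    unfolding g_def using bij by (simp add: bij_vimage_eq_inv_image)
  have borel: "f -` box l u \<in> sets borel"
    using meas by (rule measurable_sets_borel) simp
  have lm: "g ` box l u \<in> lmeasurable"
    by (rule measurable_orthogonal_image[OF g]) (simp add: bounded_set_imp_lmeasurable)
  have "emeasure (distr lborel borel f) (box l u) = emeasure lborel (f -` box l u)"
    using meas by (subst emeasure_distr) auto
  also have "\<dots> = emeasure lebesgue (g ` box l u)"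
    using borel by (simp add: vim)
  also have "\<dots> = ennreal (measure lebesgue (g ` box l u))"
    using lm by (intro emeasure_eq_measure2)
  also have "\<dots> = ennreal (measure lebesgue (box l u))"
    by (subst measure_orthogonal_image[OF g]) simp_all
  also have "\<dots> = ennreal (\<Prod>b\<in>Basis. (u - l) \<bullet> b)"
    using le by (simp add: inner_diff_left)
  finally show "emeasure (distr lborel borel f) (box l u) = ennreal (\<Prod>b\<in>Basis. (u - l) \<bullet> b)" .
qed simp

text \<open>
Identifying the complex plane with \<open>real^2\<close> transports the previous lemma, which needs coordinates,
to rotations of the complex plane.
\<close>
lemma lborel_complex_eq_distr_vec:
  "lborel = distr (lborel :: (real^2) measure) borel (\<lambda>x. Complex (x$1) (x$2))"
proof (rule lborel_eqI)
  have meas [measurable]: "(\<lambda>x::real^2. Complex (x$1) (x$2)) \<in> borel_measurable borel"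
    unfolding Complex_eq by (intro borel_measurable_continuous_onI continuous_intros)
  fix l u :: complex assume le: "\<And>b. b \<in> Basis \<Longrightarrow> l \<bullet> b \<le> u \<bullet> b"
  define l' u' :: "real^2" where "l' = vector [Re l, Im l]" and "u' = vector [Re u, Im u]"
  have le': "Re l \<le> Re u" "Im l \<le> Im u"
    using le[of 1] le[of \<i>] by (auto simp: Basis_complex_def)
  have vim: "(\<lambda>x::real^2. Complex (x$1) (x$2)) -` box l u = box l' u'"
    by (auto simp: l'_def u'_def mem_box_cart forall_2 in_box_complex_iff)
  have "emeasure (distr lborel borel (\<lambda>x::real^2. Complex (x$1) (x$2))) (box l u)
      = emeasure lborel (box l' u')"
    by (subst emeasure_distr) (auto simp: vim)
  also have "\<dots> = ennreal (\<Prod>b\<in>Basis. (u' - l') \<bullet> b)"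
    by (rule emeasure_lborel_box)
       (use le' in \<open>auto simp: l'_def u'_def Basis_vec_def cart_eq_inner_axis[symmetric] UNIV_2\<close>)
  also have "(\<Prod>b\<in>Basis. (u' - l') \<bullet> b) = (Re u - Re l) * (Im u - Im l)"
    by (simp add: Basis_vec_def UNIV_2 axis_eq_axis cart_eq_inner_axis[symmetric] l'_def u'_def)
  also have "\<dots> = (\<Prod>b\<in>Basis. (u - l) \<bullet> b)"
    by (simp add: Basis_complex_def)
  finally show "emeasure (distr lborel borel (\<lambda>x::real^2. Complex (x$1) (x$2))) (box l u)
      = ennreal (\<Prod>b\<in>Basis. (u - l) \<bullet> b)" .
qed simp

lemma lborel_distr_rotation:
  assumes w: "cmod w = 1"
  shows "distr lborel borel ((*) w) = (lborel :: complex measure)"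
proof -
  define T :: "real^2 \<Rightarrow> complex" where "T = (\<lambda>x. Complex (x$1) (x$2))"
  define f :: "real^2 \<Rightarrow> real^2"
    where "f = (\<lambda>x. vector [Re (w * T x), Im (w * T x)])"
  have T [measurable]: "T \<in> borel_measurable borel"
    unfolding T_def Complex_eq by (intro borel_measurable_continuous_onI continuous_intros)
  have normT: "cmod (T x) = norm x" for x
    by (simp add: T_def norm_vec_def L2_set_def UNIV_2 cmod_def)
  have Tf: "T (f x) = w * T x" for x
    by (simp add: f_def T_def complex_eq_iff)
  have lin: "linear f"
    by (rule linearI) (simp_all add: f_def T_def vec_eq_iff forall_2 algebra_simps)
  have orth: "orthogonal_transformation f"
    unfolding orthogonal_transformation using lin w by (metis Tf normT norm_mult mult_1)
  have f [measurable]: "f \<in> borel_measurable borel"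
    by (intro borel_measurable_continuous_onI linear_continuous_on)
       (use lin linear_conv_bounded_linear in blast)
  have "distr lborel borel ((*) w) = distr (distr lborel borel T) borel ((*) w)"
    using lborel_complex_eq_distr_vec by (simp add: T_def)
  also have "\<dots> = distr lborel borel ((*) w \<circ> T)"
    by (rule distr_distr) measurable
  also have "(*) w \<circ> T = T \<circ> f" by (auto simp: Tf)
  also have "distr lborel borel (T \<circ> f) = distr (distr lborel borel f) borel T"
    by (rule distr_distr[symmetric]) measurable
  also have "\<dots> = lborel"
    using lborel_complex_eq_distr_vec by (simp add: lborel_distr_orthogonal[OF orth] T_def)
  finally show ?thesis .
qed

section \<open>Means over circles\<close>

text \<open>
Means are based at a point \<open>z\<close> and not at a radius \<open>\<bar>z\<bar>\<close>: the parametrisation then starts at \<open>z\<close>, so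
that averaging over the circles through all \<open>z\<close> of an annulus is averaging over the rotations of the
plane.
\<close>
definition has_circle_mean :: "(complex \<Rightarrow> real) \<Rightarrow> complex \<Rightarrow> real \<Rightarrow> bool" where
  "has_circle_mean v z M \<longleftrightarrow> ((\<lambda>t. v (z * cis t)) has_integral (2 * pi * M)) {0..2*pi}"

lemma has_circle_mean_add:
  "has_circle_mean u z M \<Longrightarrow> has_circle_mean v z N \<Longrightarrow> has_circle_mean (\<lambda>z. u z + v z) z (M + N)"
  unfolding has_circle_mean_def by (drule (1) has_integral_add) (simp add: algebra_simps)

lemma has_circle_mean_cmult:
  "has_circle_mean u z M \<Longrightarrow> has_circle_mean (\<lambda>z. c * u z) z (c * M)"
  unfolding has_circle_mean_def
  by (drule has_integral_mult_right[where c=c]) (simp add: algebra_simps)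

lemma has_circle_mean_diff:
  assumes "has_circle_mean u z M" "has_circle_mean v z N"
  shows "has_circle_mean (\<lambda>z. u z - v z) z (M - N)"
  using has_circle_mean_add[OF assms(1) has_circle_mean_cmult[OF assms(2), of "-1"]] by simp

lemma has_circle_mean_const: "has_circle_mean (\<lambda>z. c) z c"
  unfolding has_circle_mean_def using has_integral_const_real[of c 0 "2*pi"] by simp

lemma has_circle_mean_sum:
  assumes "\<And>i. i \<in> I \<Longrightarrow> has_circle_mean (u i) z (M i)"
  shows "has_circle_mean (\<lambda>z. \<Sum>i\<in>I. u i z) z (\<Sum>i\<in>I. M i)"
  using assms
proof (induction I rule: infinite_finite_induct)
  case (insert i I)
  then have "has_circle_mean (\<lambda>z. u i z + (\<Sum>i\<in>I. u i z)) z (M i + (\<Sum>i\<in>I. M i))"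
    by (intro has_circle_mean_add) simp_all
  with insert.hyps show ?case by simp
qed (use has_circle_mean_const[of 0] in simp_all)

lemma has_circle_mean_cong:
  assumes "\<And>x. cmod x = cmod z \<Longrightarrow> u x = v x"
  shows "has_circle_mean u z M \<longleftrightarrow> has_circle_mean v z M"
  unfolding has_circle_mean_def
  by (intro has_integral_cong assms) (simp add: norm_mult)

text \<open>
The mean value property, read off from Cauchy's formula for \<open>x \<mapsto> H (z x)\<close> on the unit circle.
\<close>
lemma has_circle_mean_Re_holomorphic:
  assumes H: "H holomorphic_on ball 0 \<rho>" and z: "cmod z < \<rho>"
  shows "has_circle_mean (\<lambda>x. Re (H x)) z (Re (H 0))"
proof (cases "z = 0")
  case True
  show ?thesis
    unfolding True has_circle_mean_def using has_integral_const_real[of "Re (H 0)" 0 "2*pi"] by simp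
next
  case False
  define G where "G = (\<lambda>x. H (z * x))"
  have "G holomorphic_on cball 0 1"
    unfolding G_def
  proof (rule holomorphic_on_compose_gen[of "\<lambda>x. z * x" _ H, unfolded o_def, OF _ H])
    show "(*) z ` cball 0 1 \<subseteq> ball 0 \<rho>"
    proof clarsimp
      fix x :: complex assume "cmod x \<le> 1"
      then have "cmod z * cmod x \<le> cmod z * 1" by (intro mult_left_mono) auto
      then show "cmod (z * x) < \<rho>" using z by (simp add: norm_mult)
    qed
  qed (intro holomorphic_intros)
  from Cauchy_integral_circlepath_simple[OF this, of 0]
  have "((\<lambda>u. G u / u) has_contour_integral 2 * of_real pi * \<i> * G 0) (part_circlepath 0 1 0 (2*pi))"
    by (simp add: circlepath_def)
  then have "((\<lambda>t. G (cis t) / cis t * \<i> * cis t) has_integral 2 * of_real pi * \<i> * G 0) {0..2*pi}"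
    by (subst (asm) has_contour_integral_part_circlepath_iff) auto
  then have "((\<lambda>t. \<i> * G (cis t)) has_integral \<i> * (2 * of_real pi * G 0)) {0..2*pi}"
    by (simp add: mult_ac)
  from has_integral_mult_right[OF this, of "-\<i>"]
  have "((\<lambda>t. G (cis t)) has_integral (2 * of_real pi * G 0)) {0..2*pi}"
    by (simp add: mult.assoc[symmetric])
  from has_integral_Re[OF this] show ?thesis
    by (simp add: has_circle_mean_def G_def)
qed

text \<open>
As long as \<open>1 + c x\<close> stays in the right half-plane, its logarithm is the real part of a holomorphic
function that vanishes at \<open>0\<close>.
\<close>
lemma has_circle_mean_ln_one_plus:
  assumes "cmod (c * z) < 1"
  shows "has_circle_mean (\<lambda>x. ln (cmod (1 + c * x))) z 0"
proof -
  have "(\<lambda>x. Ln (1 + x)) holomorphic_on ball 0 1"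
  proof (intro holomorphic_intros)
    fix x :: complex assume "x \<in> ball 0 1"
    then have "\<bar>Re x\<bar> < 1" using abs_Re_le_cmod[of x] by simp
    then show "1 + x \<notin> \<real>\<^sub>\<le>\<^sub>0" by (auto simp: complex_nonpos_Reals_iff)
  qed
  from has_circle_mean_Re_holomorphic[OF this assms]
  have "has_circle_mean (\<lambda>x. Re (Ln (1 + x))) (c * z) 0" by simp
  then have *: "has_circle_mean (\<lambda>x. Re (Ln (1 + c * x))) z 0"
    by (simp add: has_circle_mean_def mult.assoc)
  show ?thesis
  proof (subst has_circle_mean_cong[OF _ ])
    fix x assume "cmod x = cmod z"
    then have "cmod (c * x) < 1" using assms by (simp add: norm_mult)
    then have "1 + c * x \<noteq> 0" by (metis add.inverse_unique norm_minus_cancel norm_one order_less_irrefl)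
    then show "ln (cmod (1 + c * x)) = Re (Ln (1 + c * x))" by simp
  qed (rule *)
qed

text \<open>
Jensen's formula for one zero \<open>a\<close>. If \<open>a\<close> lies outside the circle, \<open>x - a\<close> is \<open>-a\<close> times a factor
\<open>1 - x/a\<close> of logarithmic mean \<open>0\<close>. If \<open>a\<close> lies inside the circle of radius \<open>r\<close>, reflection in the circle gives
\<open>\<bar>x - a\<bar> = r \<bar>1 - cnj a x / r\<^sup>2\<bar>\<close> on the circle, and again the second factor has mean \<open>0\<close>.
\<close>
lemma has_circle_mean_ln_diff:
  assumes "cmod z \<noteq> 0" "cmod z \<noteq> cmod a"
  shows "has_circle_mean (\<lambda>x. ln (cmod (x - a))) z (ln (max (cmod z) (cmod a)))"
proof (cases "cmod z < cmod a")
  case True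
  then have a: "a \<noteq> 0" by auto
  have "has_circle_mean (\<lambda>x. ln (cmod a) + ln (cmod (1 + (- 1 / a) * x))) z (ln (cmod a) + 0)"
    by (intro has_circle_mean_add has_circle_mean_const has_circle_mean_ln_one_plus)
       (use True a in \<open>simp add: norm_divide\<close>)
  also have "?this \<longleftrightarrow> has_circle_mean (\<lambda>x. ln (cmod (x - a))) z (ln (cmod a) + 0)"
  proof (rule has_circle_mean_cong)
    fix x assume "cmod x = cmod z"
    with True have "x \<noteq> a" by auto
    have "a * (1 + (- 1 / a) * x) = a - x"
      using a by (simp add: ring_distribs)
    then have "cmod (x - a) = cmod a * cmod (1 + (- 1 / a) * x)"
      by (metis norm_minus_commute norm_mult)
    moreover have "cmod (1 + (- 1 / a) * x) > 0"
      using calculation \<open>x \<noteq> a\<close> by (metis mult_zero_right norm_eq_zero right_minus_eq zero_less_norm_iff)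
    ultimately show "ln (cmod a) + ln (cmod (1 + (- 1 / a) * x)) = ln (cmod (x - a))"
      using a by (simp add: ln_mult)
  qed
  finally show ?thesis using True by (simp add: max_def)
next
  case False
  define r where "r = cmod z"
  have r: "0 < r" "cmod a < r" using assms False by (auto simp: r_def)
  define c where "c = - cnj a / of_real (r\<^sup>2)"
  have "has_circle_mean (\<lambda>x. ln r + ln (cmod (1 + c * x))) z (ln r + 0)"
    by (intro has_circle_mean_add has_circle_mean_const has_circle_mean_ln_one_plus)
       (use r in \<open>simp add: c_def norm_divide norm_mult norm_power r_def[symmetric] power2_eq_square\<close>)
  also have "?this \<longleftrightarrow> has_circle_mean (\<lambda>x. ln (cmod (x - a))) z (ln r + 0)"
  proof (rule has_circle_mean_cong)
    fix x assume x: "cmod x = cmod z"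
    with r have "x \<noteq> a" by (auto simp: r_def)
    have xx: "cnj x * x = of_real (r\<^sup>2)"
      using complex_norm_square[of x] x by (simp add: r_def mult.commute)
    have "cmod (x - a) * r = cmod (cnj (x - a)) * cmod x"
      by (simp add: x r_def del: complex_cnj_diff)
    also have "\<dots> = cmod (cnj x * x - cnj a * x)"
      unfolding norm_mult[symmetric] by (simp add: algebra_simps)
    also have "cnj x * x - cnj a * x = of_real (r\<^sup>2) * (1 + c * x)"
      unfolding xx using r by (simp add: c_def ring_distribs)
    also have "cmod (of_real (r\<^sup>2) * (1 + c * x)) = r * r * cmod (1 + c * x)"
      by (simp add: norm_mult norm_power power2_eq_square)
    finally have *: "cmod (x - a) = r * cmod (1 + c * x)"
      using r by simp
    moreover have "cmod (1 + c * x) > 0"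
      using * \<open>x \<noteq> a\<close> by (metis mult_zero_right norm_eq_zero right_minus_eq zero_less_norm_iff)
    ultimately show "ln r + ln (cmod (1 + c * x)) = ln (cmod (x - a))"
      using r by (simp add: ln_mult)
  qed
  finally show ?thesis using False by (simp add: max_def r_def)
qed

section \<open>Jensen's formula for entire functions\<close>

text \<open>
The quotient of \<open>f\<close> by the power \<open>(z - a) ^ n\<close> is holomorphic off \<open>a\<close>, and near \<open>a\<close> it agrees with the
local cofactor of \<open>f\<close>.
\<close>
lemma factor_out_zero:
  assumes f: "f holomorphic_on S" and S: "open S" "connected S" and a: "a \<in> S" "f a = 0"
    and nonconst: "\<not> f constant_on S"
  obtains g n where "g holomorphic_on S" "g a \<noteq> 0" "\<And>z. z \<in> S \<Longrightarrow> f z = (z - a) ^ n * g z"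
proof -
  obtain h r n where h: "0 < n" "0 < r" "ball a r \<subseteq> S" "h holomorphic_on ball a r"
      "\<And>w. w \<in> ball a r \<Longrightarrow> f w = (w - a) ^ n * h w" "\<And>w. w \<in> ball a r \<Longrightarrow> h w \<noteq> 0"
    using holomorphic_factor_zero_nonconstant[OF f S a nonconst] by metis
  define g where "g = (\<lambda>z. if z = a then h a else f z / (z - a) ^ n)"
  have gh: "g w = h w" if "w \<in> ball a r" for w
    using h(5)[OF that] by (simp add: g_def)
  have "g holomorphic_on (S - {a})"
  proof (rule holomorphic_transform)
    show "(\<lambda>z. f z / (z - a) ^ n) holomorphic_on S - {a}"
      by (intro holomorphic_intros holomorphic_on_subset[OF f]) auto
  qed (simp add: g_def)
  moreover have "g holomorphic_on ball a r"
    using h(4) by (rule holomorphic_transform) (simp add: gh)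
  ultimately have "g holomorphic_on (S - {a}) \<union> ball a r"
    by (rule holomorphic_on_Un) (use S in auto)
  also have "(S - {a}) \<union> ball a r = S" using h a by auto
  finally have "g holomorphic_on S" .
  moreover have "g a \<noteq> 0" using h by (simp add: g_def)
  moreover have "f z = (z - a) ^ n * g z" if "z \<in> S" for z
    using a h(1) by (simp add: g_def)
  ultimately show ?thesis using that by blast
qed

lemma factor_out_finite_zeros:
  assumes "finite Z" "f holomorphic_on S" "open S" "connected S" "{z \<in> S. f z = 0} = Z"
    and "\<not> S \<subseteq> Z"
  shows "\<exists>g m. g holomorphic_on S \<and> (\<forall>z\<in>S. g z \<noteq> 0 \<and> f z = g z * (\<Prod>a\<in>Z. (z - a) ^ m a))"
  using assms
proof (induction Z arbitrary: f rule: finite_induct)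
  case empty
  then show ?case by (intro exI[of _ f] exI[of _ "\<lambda>_. 0"]) auto
next
  case (insert a Z)
  note S = \<open>open S\<close> \<open>connected S\<close> and f = \<open>f holomorphic_on S\<close>
  have a: "a \<in> S" "f a = 0" using insert.prems by auto
  have "\<not> f constant_on S"
    using insert.prems a unfolding constant_on_def by (metis (mono_tags, lifting) mem_Collect_eq subsetI)
  from factor_out_zero[OF f S a this] obtain g n where
    g: "g holomorphic_on S" "g a \<noteq> 0" "\<And>z. z \<in> S \<Longrightarrow> f z = (z - a) ^ n * g z"
    by blast
  have n: "n \<noteq> 0" using g(2) g(3)[of a] a by (metis mult_cancel_right2 power_0)
  have "{z \<in> S. g z = 0} = Z"
  proof -
    have "{z \<in> S. g z = 0} = {z \<in> S. f z = 0} - {a}"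
      using g n by auto
    with insert.prems insert.hyps show ?thesis by auto
  qed
  from insert.IH[OF g(1) S this] insert.prems obtain G m where
    G: "G holomorphic_on S" "\<And>z. z \<in> S \<Longrightarrow> G z \<noteq> 0 \<and> g z = G z * (\<Prod>a\<in>Z. (z - a) ^ m a)"
    by blast
  have "(\<Prod>b\<in>Z. (z - b) ^ (m(a := n)) b) = (\<Prod>b\<in>Z. (z - b) ^ m b)" for z
    using insert.hyps by (intro prod.cong) auto
  then have "f z = G z * (\<Prod>b\<in>insert a Z. (z - b) ^ (m(a := n)) b)" if "z \<in> S" for z
    using g(3)[OF that] G(2)[OF that] insert.hyps by simp
  with G show ?case by blast
qed

text \<open>
Only finitely many zeros lie in a ball, and the zero-free cofactor has a holomorphic logarithm there
because the ball is convex.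
\<close>
lemma entire_factorization_on_ball:
  assumes f: "f holomorphic_on UNIV" and nz: "f z0 \<noteq> 0"
  obtains H Z m where "H holomorphic_on ball 0 \<rho>" "finite Z"
    "\<And>z. z \<in> ball 0 \<rho> \<Longrightarrow> f z = exp (H z) * (\<Prod>a\<in>Z. (z - a) ^ m a)"
proof (cases "\<rho> > 0")
  case False
  show ?thesis
  proof (rule that[of "\<lambda>_. 0" "{}"])
    fix z :: complex assume "z \<in> ball 0 \<rho>"
    then have "cmod z < \<rho>" by simp
    with False norm_ge_zero[of z] show "f z = exp 0 * (\<Prod>a\<in>{}. (z - a) ^ 0)" by linarith
  qed auto
next
  case True
  define Z where "Z = {z \<in> ball 0 \<rho>. f z = 0}"
  have fin: "finite {z \<in> cball 0 \<rho>. f z = 0}"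
  proof (cases "f constant_on UNIV")
    case True
    with nz have "{z \<in> cball 0 \<rho>. f z = 0} = {}" by (auto simp: constant_on_def)
    then show ?thesis by (metis finite.emptyI)
  next
    case False
    then show ?thesis by (intro holomorphic_compact_finite_zeros[OF f]) auto
  qed
  then have finZ: "finite Z" by (rule rev_finite_subset) (auto simp: Z_def)
  have "\<not> ball 0 \<rho> \<subseteq> Z"
    using True finZ finite_subset uncountable_ball[of \<rho> "0::complex"] countable_finite by blast
  from factor_out_finite_zeros[OF finZ holomorphic_on_subset[OF f subset_UNIV] open_ball
      connected_ball Z_def[symmetric] this]
  obtain g m where g: "g holomorphic_on ball 0 \<rho>"
      "\<And>z. z \<in> ball 0 \<rho> \<Longrightarrow> g z \<noteq> 0 \<and> f z = g z * (\<Prod>a\<in>Z. (z - a) ^ m a)"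
    by blast
  obtain H where "H holomorphic_on ball 0 \<rho>" "\<And>z. z \<in> ball 0 \<rho> \<Longrightarrow> exp (H z) = g z"
    using holomorphic_logarithm_exists[of "ball 0 \<rho>" g 0] g True by auto
  with that[of H Z m] finZ g show ?thesis by auto
qed

text \<open>
Jensen's formula. The radii \<open>cmod ` Z\<close> are excluded, since there the integrand is singular on the circle; they
form a finite set and do not affect area integrals.
\<close>
lemma has_circle_mean_ln_entire:
  assumes f: "f holomorphic_on UNIV" and nz: "f z0 \<noteq> 0"
  shows "\<exists>c Z (m :: complex \<Rightarrow> nat). finite Z \<and>
    (\<forall>z. z \<noteq> 0 \<and> cmod z < \<rho> \<and> cmod z \<notin> cmod ` Z \<longrightarrow>
      has_circle_mean (\<lambda>x. ln (cmod (f x))) z (c + (\<Sum>a\<in>Z. real (m a) * ln (max (cmod z) (cmod a)))))"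
proof -
  from entire_factorization_on_ball[OF f nz, of \<rho>] obtain H Z m where
    H: "H holomorphic_on ball 0 \<rho>" and Z: "finite Z" and
    fac: "\<And>z. z \<in> ball 0 \<rho> \<Longrightarrow> f z = exp (H z) * (\<Prod>a\<in>Z. (z - a) ^ m a)"
    by blast
  show ?thesis
  proof (intro exI[of _ "Re (H 0)"] exI[of _ Z] exI[of _ m] conjI Z allI impI)
    fix z assume "z \<noteq> 0 \<and> cmod z < \<rho> \<and> cmod z \<notin> cmod ` Z"
    then have z: "z \<noteq> 0" "cmod z < \<rho>" "cmod z \<notin> cmod ` Z" by auto
    have "has_circle_mean (\<lambda>x. Re (H x) + (\<Sum>a\<in>Z. real (m a) * ln (cmod (x - a)))) z
       (Re (H 0) + (\<Sum>a\<in>Z. real (m a) * ln (max (cmod z) (cmod a))))"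
    proof (intro has_circle_mean_add[OF has_circle_mean_Re_holomorphic[OF H z(2)]]
                 has_circle_mean_sum has_circle_mean_cmult has_circle_mean_ln_diff)
      fix a assume "a \<in> Z"
      then show "cmod z \<noteq> cmod a" using z(3) by auto
    qed (use z in auto)
    also have "?this \<longleftrightarrow> has_circle_mean (\<lambda>x. ln (cmod (f x))) z
       (Re (H 0) + (\<Sum>a\<in>Z. real (m a) * ln (max (cmod z) (cmod a))))"
    proof (rule has_circle_mean_cong)
      fix x assume x: "cmod x = cmod z"
      with z(2) have xb: "x \<in> ball 0 \<rho>" by simp
      from x z(3) have xZ: "x \<notin> Z" by (metis image_eqI)
      have prodpos: "0 < (\<Prod>a\<in>Z. cmod (x - a) ^ m a)"
        using xZ by (intro prod_pos zero_less_power) auto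
      have "cmod (f x) = exp (Re (H x)) * (\<Prod>a\<in>Z. cmod (x - a) ^ m a)"
        by (simp add: fac[OF xb] norm_mult norm_power flip: prod_norm)
      also have "ln \<dots> = Re (H x) + ln (\<Prod>a\<in>Z. cmod (x - a) ^ m a)"
        using prodpos by (simp add: ln_mult)
      also have "ln (\<Prod>a\<in>Z. cmod (x - a) ^ m a) = (\<Sum>a\<in>Z. ln (cmod (x - a) ^ m a))"
        using xZ Z by (intro ln_prod) auto
      also have "\<dots> = (\<Sum>a\<in>Z. real (m a) * ln (cmod (x - a)))"
        using xZ by (intro sum.cong refl ln_realpow)
      finally show "Re (H x) + (\<Sum>a\<in>Z. real (m a) * ln (cmod (x - a))) = ln (cmod (f x))" ..
    qed
    finally show "has_circle_mean (\<lambda>x. ln (cmod (f x))) z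
       (Re (H 0) + (\<Sum>a\<in>Z. real (m a) * ln (max (cmod z) (cmod a))))" .
  qed
qed

section \<open>Circle means of logarithmic canonical products\<close>

text \<open>
The factors whose zeros lie outside the ball contribute a harmonic function: on the ball the series of
logarithms converges uniformly, since \<open>\<bar>Ln (1 + w)\<bar> \<le> 2 \<bar>w\<bar>\<close> for small \<open>w\<close>.
\<close>
lemma sum_Ln_holomorphic:
  fixes r :: "nat \<Rightarrow> real"
  assumes "\<rho> > 0" and r: "\<And>i. \<rho> \<le> r i" and summ: "summable (\<lambda>i. 1 / r i)"
  obtains G where "G holomorphic_on ball 0 \<rho>"
    "\<And>x. x \<in> ball 0 \<rho> \<Longrightarrow> (\<lambda>i. Ln (1 - x / of_real (r i))) sums G x"
proof -
  have rpos: "0 < r i" for i using r[of i] \<open>\<rho> > 0\<close> by linarith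
  have "\<exists>g. \<forall>x\<in>ball 0 \<rho>. (\<lambda>i. Ln (1 - x / of_real (r i))) sums g x \<and> g field_differentiable (at x)"
  proof (rule series_differentiable_comparison_complex[of "ball 0 \<rho>" "\<lambda>i x. Ln (1 - x / of_real (r i))"])
    fix i and x :: complex assume x: "x \<in> ball 0 \<rho>"
    have "cmod (x / of_real (r i)) < 1"
      using x r[of i] rpos[of i] by (simp add: norm_divide)
    then have "Re (x / of_real (r i)) < 1"
      using complex_Re_le_cmod order_le_less_trans by blast
    then have "0 < Re (1 - x / of_real (r i))" by (simp only: minus_complex.sel one_complex.sel)
    then have "1 - x / of_real (r i) \<notin> \<real>\<^sub>\<le>\<^sub>0" by (metis complex_nonpos_Reals_iff not_le)
    then show "(\<lambda>x. Ln (1 - x / of_real (r i))) field_differentiable at x"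
      using rpos[of i] unfolding field_differentiable_def by (auto intro!: exI derivative_eq_intros)
  next
    fix x :: complex assume "x \<in> ball 0 \<rho>"
    have "(\<lambda>i. 1 / r i) \<longlonglongrightarrow> 0" using summ by (rule summable_LIMSEQ_zero)
    then have "\<forall>\<^sub>F i in sequentially. 1 / r i < 1 / (2 * \<rho>)"
      using \<open>\<rho> > 0\<close> by (intro order_tendstoD) auto
    then have "\<forall>\<^sub>F i in sequentially. \<forall>y\<in>ball x 1 \<inter> ball 0 \<rho>.
        cmod (Ln (1 - y / of_real (r i))) \<le> cmod (complex_of_real (2 * \<rho> * (1 / r i)))"
    proof eventually_elim
      case (elim i)
      show ?case
      proof
        fix y assume y: "y \<in> ball x 1 \<inter> ball 0 \<rho>"
        have le: "cmod (- y / of_real (r i)) \<le> \<rho> * (1 / r i)"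
          using y rpos[of i] by (simp add: norm_divide divide_right_mono)
        also have "\<dots> < \<rho> * (1 / (2 * \<rho>))" using elim \<open>\<rho> > 0\<close> by (rule mult_strict_left_mono)
        also have "\<dots> = 1 / 2" using \<open>\<rho> > 0\<close> by simp
        finally have "cmod (Ln (1 + - y / of_real (r i))) \<le> 2 * cmod (- y / of_real (r i))"
          by (rule norm_Ln_le)
        also have "\<dots> \<le> 2 * (\<rho> * (1 / r i))" using le by simp
        also have "\<dots> = cmod (complex_of_real (2 * \<rho> * (1 / r i)))"
          using \<open>\<rho> > 0\<close> rpos[of i] by (simp only: norm_of_real) simp
        finally show "cmod (Ln (1 - y / of_real (r i))) \<le> cmod (complex_of_real (2 * \<rho> * (1 / r i)))"
          by simp
      qed
    qed
    moreover have "summable (\<lambda>i. complex_of_real (2 * \<rho> * (1 / r i)))"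
      by (intro summable_of_real summable_mult summ)
    moreover have "range (\<lambda>i. complex_of_real (2 * \<rho> * (1 / r i))) \<subseteq> \<real>\<^sub>\<ge>\<^sub>0"
      using \<open>\<rho> > 0\<close> rpos by (auto intro!: mult_nonneg_nonneg divide_nonneg_nonneg simp: less_imp_le complex_nonneg_Reals_iff)
    ultimately show "\<exists>d h. 0 < d \<and> summable h \<and> range h \<subseteq> \<real>\<^sub>\<ge>\<^sub>0 \<and>
       (\<forall>\<^sub>F n in sequentially. \<forall>y\<in>ball x d \<inter> ball 0 \<rho>. cmod (Ln (1 - y / of_real (r n))) \<le> cmod (h n))"
      by (intro exI[of _ 1] exI[of _ "\<lambda>i. complex_of_real (2 * \<rho> * (1 / r i))"]) simp
  qed (use that in blast)+
  then obtain g where g: "\<And>x. x \<in> ball 0 \<rho> \<Longrightarrow> (\<lambda>i. Ln (1 - x / of_real (r i))) sums g x"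
      "\<And>x. x \<in> ball 0 \<rho> \<Longrightarrow> g field_differentiable (at x)" by blast
  then show ?thesis
    by (intro that[of g]) (auto simp: holomorphic_on_def intro: field_differentiable_at_within)
qed

text \<open>
The zeros outside the circle contribute the real part of a holomorphic function that vanishes at \<open>0\<close>,
hence nothing; those inside contribute according to \<open>has_circle_mean_ln_diff\<close>.
\<close>
lemma has_circle_mean_log_product:
  fixes r :: "nat \<Rightarrow> real"
  assumes pos: "\<And>i. 0 < r i" and mono: "mono r" and summ: "summable (\<lambda>i. 1 / r i)"
    and below: "\<And>i. i < k \<Longrightarrow> r i < cmod z" and above: "cmod z < r k" and "z \<noteq> 0"
  shows "has_circle_mean (\<lambda>x. \<Sum>i. ln (cmod (1 - x / of_real (r i)))) z
           (\<Sum>i<k. ln (cmod z) - ln (r i))"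
proof -
  have ge: "r k \<le> r (i + k)" for i using mono by (simp add: monoD)
  have "summable (\<lambda>i. 1 / r (i + k))" using summ by (subst summable_iff_shift)
  from sum_Ln_holomorphic[OF pos ge this] obtain G where
    G: "G holomorphic_on ball 0 (r k)"
       "\<And>x. x \<in> ball 0 (r k) \<Longrightarrow> (\<lambda>i. Ln (1 - x / of_real (r (i + k)))) sums G x"
    by blast
  have "G 0 = 0"
    using sums_unique[OF G(2)[of 0]] pos by simp
  with has_circle_mean_Re_holomorphic[OF G(1) above]
  have mG: "has_circle_mean (\<lambda>x. Re (G x)) z 0" by simp
  have "has_circle_mean (\<lambda>x. Re (G x) + (\<Sum>i<k. ln (cmod (x - of_real (r i))) - ln (r i))) z
     (0 + (\<Sum>i<k. ln (max (cmod z) (cmod (of_real (r i)))) - ln (r i)))"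
    by (intro has_circle_mean_add[OF mG] has_circle_mean_sum has_circle_mean_diff
          has_circle_mean_ln_diff has_circle_mean_const)
       (use \<open>z \<noteq> 0\<close> pos below in \<open>force simp: less_imp_le\<close>)+
  also have "(0 + (\<Sum>i<k. ln (max (cmod z) (cmod (of_real (r i)))) - ln (r i)))
     = (\<Sum>i<k. ln (cmod z) - ln (r i))"
    unfolding add_0_left
  proof (intro sum.cong refl)
    fix i assume "i \<in> {..<k}"
    then have "max (cmod z) (cmod (of_real (r i))) = cmod z"
      using pos[of i] below[of i] by simp
    then show "ln (max (cmod z) (cmod (of_real (r i)))) - ln (r i) = ln (cmod z) - ln (r i)" by simp
  qed
  also have "has_circle_mean (\<lambda>x. Re (G x) + (\<Sum>i<k. ln (cmod (x - of_real (r i))) - ln (r i))) z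
        (\<Sum>i<k. ln (cmod z) - ln (r i)) \<longleftrightarrow> ?thesis"
  proof (rule has_circle_mean_cong)
    fix x assume x: "cmod x = cmod z"
    have xb: "x \<in> ball 0 (r k)" using x above by simp
    have tail: "(\<lambda>i. ln (cmod (1 - x / of_real (r (i + k))))) sums Re (G x)"
    proof -
      have "Re (Ln (1 - x / of_real (r (i + k)))) = ln (cmod (1 - x / of_real (r (i + k))))" for i
      proof -
        have "cmod x < r (i + k)" using ge[of i] x above by simp
        then have "1 - x / of_real (r (i + k)) \<noteq> 0"
          using pos[of "i + k"] by (auto simp: field_simps)
        then show ?thesis by simp
      qed
      with sums_Re[OF G(2)[OF xb]] show ?thesis by simp
    qed
    have head: "ln (cmod (1 - x / of_real (r i))) = ln (cmod (x - of_real (r i))) - ln (r i)" if "i < k" for i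
    proof -
      have "x \<noteq> of_real (r i)" using below[OF that] x pos[of i] by auto
      moreover have "1 - x / of_real (r i) = (of_real (r i) - x) / of_real (r i)"
        using pos[of i] by (simp add: field_simps)
      ultimately show ?thesis
        using pos[of i] by (simp add: norm_divide ln_div norm_minus_commute)
    qed
    have "(\<lambda>i. ln (cmod (1 - x / of_real (r i)))) sums
            (Re (G x) + (\<Sum>i<k. ln (cmod (1 - x / of_real (r i)))))"
      using tail by (subst (asm) sums_iff_shift)
    then have "(\<Sum>i. ln (cmod (1 - x / of_real (r i))))
        = Re (G x) + (\<Sum>i<k. ln (cmod (1 - x / of_real (r i))))"
      by (simp add: sums_iff)
    also have "(\<Sum>i<k. ln (cmod (1 - x / of_real (r i)))) = (\<Sum>i<k. ln (cmod (x - of_real (r i))) - ln (r i))"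
      by (intro sum.cong refl head) auto
    finally show "Re (G x) + (\<Sum>i<k. ln (cmod (x - of_real (r i))) - ln (r i))
      = (\<Sum>i. ln (cmod (1 - x / of_real (r i))))" ..
  qed
  finally show ?thesis .
qed

section \<open>From circle means to area integrals\<close>

text \<open>
A mean is defined through the gauge integral, which may exist without absolute convergence. The
inequality survives, since it is trivial when the right-hand side is infinite.
\<close>
lemma ennreal_abs_integral_le_nn_integral:
  fixes g :: "real \<Rightarrow> real"
  assumes g: "(g has_integral I) S" and [measurable]: "g \<in> borel_measurable borel" "S \<in> sets borel"
  shows "ennreal \<bar>I\<bar> \<le> (\<integral>\<^sup>+t\<in>S. ennreal \<bar>g t\<bar> \<partial>lborel)"
proof (cases "(\<integral>\<^sup>+t\<in>S. ennreal \<bar>g t\<bar> \<partial>lborel) = \<infinity>")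
  case False
  have eq: "(\<integral>\<^sup>+t\<in>S. ennreal \<bar>g t\<bar> \<partial>lborel) = (\<integral>\<^sup>+t. ennreal (norm (indicator S t *\<^sub>R g t)) \<partial>lborel)"
    by (intro nn_integral_cong) (auto simp: indicator_def)
  have "(\<integral>\<^sup>+t. ennreal (norm (indicator S t *\<^sub>R g t)) \<partial>lborel) < \<infinity>"
    using False unfolding eq by (simp only: less_top infinity_ennreal_def)
  then have int: "set_integrable lborel S g"
    unfolding set_integrable_def by (rule integrableI_bounded[rotated]) measurable
  have "I = (LINT t:S|lborel. g t)"
    using set_borel_integral_eq_integral(2)[OF int] integral_unique[OF g] by simp
  then have "ennreal \<bar>I\<bar> = ennreal (norm (LINT t|lborel. indicator S t *\<^sub>R g t))"
    by (simp add: set_lebesgue_integral_def)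
  also have "\<dots> \<le> (\<integral>\<^sup>+t. ennreal (norm (indicator S t *\<^sub>R g t)) \<partial>lborel)"
    using int unfolding set_integrable_def by (rule integral_norm_bound_ennreal)
  finally show ?thesis by (simp add: eq)
qed simp

lemma nn_integral_rotation:
  assumes "f \<in> borel_measurable borel" "cmod w = 1"
  shows "(\<integral>\<^sup>+z. f (z * w) \<partial>lborel) = (\<integral>\<^sup>+z. f z \<partial>lborel)"
proof -
  have "(\<integral>\<^sup>+z. f z \<partial>lborel) = (\<integral>\<^sup>+z. f z \<partial>distr lborel borel ((*) w))"
    using assms by (simp add: lborel_distr_rotation)
  also have "\<dots> = (\<integral>\<^sup>+z. f (w * z) \<partial>lborel)"
    using assms by (subst nn_integral_distr) auto
  finally show ?thesis by (simp add: mult.commute)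
qed

text \<open>
Circles are null sets, so removing finitely many of them does not change the area of an annulus.
\<close>
lemma emeasure_annulus_minus_circles:
  assumes "0 \<le> a" "a < b" "finite F"
  shows "emeasure lborel {z::complex. a < cmod z \<and> cmod z < b \<and> cmod z \<notin> F} = ennreal (pi * (b\<^sup>2 - a\<^sup>2))"
proof -
  define C where "C = (\<Union>r\<in>F. sphere (0::complex) r)"
  have "sphere (0::complex) r \<in> null_sets lborel" for r
    using negligible_sphere[of "0::complex" r] by (simp add: negligible_iff_null_sets null_sets_completion_iff)
  then have C: "C \<in> null_sets lborel"
    unfolding C_def using \<open>finite F\<close> by (intro null_sets_UN' countable_finite)
  have "{z::complex. a < cmod z \<and> cmod z < b \<and> cmod z \<notin> F} = (ball 0 b - cball 0 a) - C"
    by (auto simp: C_def)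
  also have "emeasure lborel \<dots> = emeasure lborel (ball 0 b - cball (0::complex) a)"
    by (rule emeasure_Diff_null_set[OF C]) simp
  also have "\<dots> = emeasure lborel (ball (0::complex) b) - emeasure lborel (cball (0::complex) a)"
    using assms by (intro emeasure_Diff) (auto simp: emeasure_cball)
  also have "\<dots> = ennreal (pi * b\<^sup>2) - ennreal (pi * a\<^sup>2)"
    using assms by (simp add: emeasure_ball emeasure_cball unit_ball_vol_2)
  also have "\<dots> = ennreal (pi * (b\<^sup>2 - a\<^sup>2))"
    by (simp add: ennreal_minus algebra_simps)
  finally show ?thesis .
qed

text \<open>
Instead of passing to polar coordinates, the proof integrates \<open>\<bar>v (z * cis t)\<bar>\<close> over \<open>z\<close> in the annulus and all
angles \<open>t\<close>: for fixed \<open>z\<close> this is at least \<open>2 pi K\<close>, and for fixed \<open>t\<close> it is the mass of \<open>v\<close> on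
the annulus, because rotations preserve area.
\<close>
lemma circle_mean_lower_bound_imp_L1_lower_bound:
  assumes v [measurable]: "v \<in> borel_measurable borel"
    and ab: "0 \<le> a" "a < b" and "finite F"
    and mean: "\<And>z. a < cmod z \<Longrightarrow> cmod z < b \<Longrightarrow> cmod z \<notin> F \<Longrightarrow> has_circle_mean v z (M (cmod z))"
    and K: "\<And>r. a < r \<Longrightarrow> r < b \<Longrightarrow> K \<le> \<bar>M r\<bar>" "0 \<le> K"
  shows "ennreal (K * (pi * (b\<^sup>2 - a\<^sup>2))) \<le> (\<integral>\<^sup>+z\<in>ball 0 b. ennreal \<bar>v z\<bar> \<partial>lborel)"
proof -
  define A where "A = {z::complex. a < cmod z \<and> cmod z < b \<and> cmod z \<notin> F}"
  have "A = (ball 0 b - cball 0 a) - (\<Union>r\<in>F. sphere 0 r)" by (auto simp: A_def)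
  moreover have "closed (\<Union>r\<in>F. sphere (0::complex) r)"
    using \<open>finite F\<close> by (intro closed_UN) auto
  ultimately have A [measurable]: "A \<in> sets borel"
    by (simp add: borel_closed)
  have A_rot: "z * cis t \<in> A \<longleftrightarrow> z \<in> A" for z t by (simp add: A_def norm_mult)
  define J where "J = (\<integral>\<^sup>+z\<in>A. ennreal \<bar>v z\<bar> \<partial>lborel)"
  have cis [measurable]: "cis \<in> borel_measurable borel"
    by (intro borel_measurable_continuous_onI continuous_intros)
  have "ennreal (2 * pi) * ennreal (K * (pi * (b\<^sup>2 - a\<^sup>2))) = (\<integral>\<^sup>+z\<in>A. ennreal (2 * pi * K) \<partial>lborel)"
    using emeasure_annulus_minus_circles[OF ab \<open>finite F\<close>] ab \<open>0 \<le> K\<close>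
    by (simp add: nn_integral_cmult_indicator A_def[symmetric] mult.assoc flip: ennreal_mult)
  also have "\<dots> \<le> (\<integral>\<^sup>+z\<in>A. (\<integral>\<^sup>+t\<in>{0..2*pi}. ennreal \<bar>v (z * cis t)\<bar> \<partial>lborel) \<partial>lborel)"
  proof (rule nn_integral_mono)
    fix z :: complex
    have "ennreal (2 * pi * K) \<le> (\<integral>\<^sup>+t\<in>{0..2*pi}. ennreal \<bar>v (z * cis t)\<bar> \<partial>lborel)" if "z \<in> A"
    proof -
      have "2 * pi * K \<le> \<bar>2 * pi * M (cmod z)\<bar>"
        using K(1)[of "cmod z"] that by (simp add: A_def abs_mult)
      then have "ennreal (2 * pi * K) \<le> ennreal \<bar>2 * pi * M (cmod z)\<bar>"
        by (rule ennreal_leI)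
      also have "\<dots> \<le> (\<integral>\<^sup>+t\<in>{0..2*pi}. ennreal \<bar>v (z * cis t)\<bar> \<partial>lborel)"
        using mean[of z] that unfolding has_circle_mean_def A_def
        by (intro ennreal_abs_integral_le_nn_integral) auto
      finally show ?thesis .
    qed
    then show "ennreal (2 * pi * K) * indicator A z \<le>
        (\<integral>\<^sup>+t\<in>{0..2*pi}. ennreal \<bar>v (z * cis t)\<bar> \<partial>lborel) * indicator A z"
      by (auto simp: indicator_def)
  qed
  also have "\<dots> = (\<integral>\<^sup>+z. (\<integral>\<^sup>+t. ennreal \<bar>v (z * cis t)\<bar> * indicator {0..2*pi} t * indicator A z \<partial>lborel) \<partial>lborel)"
    by (intro nn_integral_cong nn_integral_multc[symmetric]) measurable
  also have "\<dots> = (\<integral>\<^sup>+t. (\<integral>\<^sup>+z. ennreal \<bar>v (z * cis t)\<bar> * indicator {0..2*pi} t * indicator A z \<partial>lborel) \<partial>lborel)"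
    by (rule lborel_pair.Fubini'[symmetric]) measurable
  also have "\<dots> = (\<integral>\<^sup>+t. J * indicator {0..2*pi} t \<partial>lborel)"
  proof (rule nn_integral_cong)
    fix t :: real
    have "(\<integral>\<^sup>+z. ennreal \<bar>v (z * cis t)\<bar> * indicator {0..2*pi} t * indicator A z \<partial>lborel)
        = (\<integral>\<^sup>+z. (\<lambda>z. ennreal \<bar>v z\<bar> * indicator {0..2*pi} t * indicator A z) (z * cis t) \<partial>lborel)"
      by (simp add: indicator_def A_rot)
    also have "\<dots> = (\<integral>\<^sup>+z. ennreal \<bar>v z\<bar> * indicator {0..2*pi} t * indicator A z \<partial>lborel)"
      by (rule nn_integral_rotation) simp_all
    also have "\<dots> = J * indicator {0..2*pi} t"
      unfolding J_def by (subst nn_integral_multc[symmetric]) (auto simp: mult_ac)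
    finally show "(\<integral>\<^sup>+z. ennreal \<bar>v (z * cis t)\<bar> * indicator {0..2*pi} t * indicator A z \<partial>lborel)
        = J * indicator {0..2*pi} t" .
  qed
  also have "\<dots> = ennreal (2 * pi) * J"
    by (simp add: nn_integral_cmult_indicator mult.commute)
  finally have "ennreal (K * (pi * (b\<^sup>2 - a\<^sup>2))) \<le> J"
    by (subst (asm) ennreal_mult_le_mult_iff) auto
  also have "J \<le> (\<integral>\<^sup>+z\<in>ball 0 b. ennreal \<bar>v z\<bar> \<partial>lborel)"
    unfolding J_def by (intro nn_integral_mono) (auto simp: indicator_def A_def)
  finally show ?thesis .
qed

section \<open>Drift of the circle means\<close>

text \<open>
The fractional parts of \<open>- \<alpha>\<close> and \<open>1/2 - \<alpha>\<close> are opposite on the circle of reals modulo \<open>1\<close>, so one of them is at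
distance at least \<open>1/4\<close> from \<open>0\<close>.
\<close>
lemma exists_half_integer_far_from_integers:
  fixes \<alpha> :: real
  assumes "0 \<le> \<alpha>" "\<alpha> < 1"
  obtains j :: nat where "\<And>n::int. 1/4 \<le> \<bar>real j / 2 - \<alpha> - of_int n\<bar>"
proof (cases "1/4 \<le> \<alpha> \<and> \<alpha> \<le> 3/4")
  case True
  have "1/4 \<le> \<bar>real 0 / 2 - \<alpha> - of_int n\<bar>" for n :: int
  proof (cases "n \<ge> 0")
    case False
    then have "of_int n \<le> (-1::real)" by linarith
    with True show ?thesis by linarith
  qed (use True in \<open>simp add: abs_if; linarith\<close>)
  then show ?thesis by (rule that)
next
  case False
  have "1/4 \<le> \<bar>real 1 / 2 - \<alpha> - of_int n\<bar>" for n :: int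
  proof -
    consider "n = 0" | "1 \<le> n" | "n \<le> -1" by linarith
    then show ?thesis
    proof cases
      case 1
      with False assms show ?thesis by (simp add: abs_if) linarith
    next
      case 2
      then have "1 \<le> (of_int n :: real)" by linarith
      with assms show ?thesis by (simp add: abs_if)
    next
      case 3
      then have "of_int n \<le> (-1::real)" by linarith
      with assms show ?thesis by (simp add: abs_if)
    qed
  qed
  then show ?thesis by (rule that)
qed

text \<open>
As a function of \<open>ln x\<close>, \<open>g\<close> is concave with slopes in \<open>\<beta> - \<int>\<close>, none of which lies in \<open>{-1/4<..<1/4}\<close>.
Hence the slope is at least \<open>1/4\<close> on the whole left interval or at most \<open>-1/4\<close> on the whole right
one, according to the sign of \<open>\<beta> - N\<close>, where \<open>N\<close> counts the points of modulus
at most \<open>x2\<close> with their multiplicities \<open>m\<close>.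
\<close>
lemma log_drift:
  fixes m :: "complex \<Rightarrow> nat" and Z :: "complex set" and \<beta> :: real
  assumes x: "0 < x1" "x1 < x2" "x2 < x3"
    and gap: "\<And>n::int. 1/4 \<le> \<bar>\<beta> - of_int n\<bar>"
  defines "g \<equiv> (\<lambda>x. \<beta> * ln x - (\<Sum>a\<in>Z. real (m a) * ln (max x (cmod a))))"
  shows "ln x2 - ln x1 \<le> 4 * (g x2 - g x1) \<or> ln x3 - ln x2 \<le> 4 * (g x2 - g x3)"
proof -
  define N where "N = (\<Sum>a\<in>Z. if cmod a \<le> x2 then m a else 0)"
  have N: "real N * t = (\<Sum>a\<in>Z. if cmod a \<le> x2 then real (m a) * t else 0)" for t
    unfolding N_def of_nat_sum sum_distrib_right by (intro sum.cong) auto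
  have ln12: "ln x1 < ln x2" and ln23: "ln x2 < ln x3" using x by auto
  have "(\<Sum>a\<in>Z. real (m a) * ln (max x2 (cmod a))) - (\<Sum>a\<in>Z. real (m a) * ln (max x1 (cmod a)))
      \<le> real N * (ln x2 - ln x1)"
    unfolding N sum_subtractf[symmetric]
  proof (rule sum_mono)
    fix a
    have "ln (max x2 (cmod a)) - ln (max x1 (cmod a)) \<le> (if cmod a \<le> x2 then ln x2 - ln x1 else 0)"
      using x by (auto simp: max_def intro!: ln_mono)
    from mult_left_mono[OF this, of "real (m a)"]
    show "real (m a) * ln (max x2 (cmod a)) - real (m a) * ln (max x1 (cmod a))
      \<le> (if cmod a \<le> x2 then real (m a) * (ln x2 - ln x1) else 0)"
      by (auto simp: algebra_simps split: if_splits)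
  qed
  then have left: "(\<beta> - real N) * (ln x2 - ln x1) \<le> g x2 - g x1"
    by (simp add: g_def algebra_simps)
  have "real N * (ln x3 - ln x2) \<le>
     (\<Sum>a\<in>Z. real (m a) * ln (max x3 (cmod a))) - (\<Sum>a\<in>Z. real (m a) * ln (max x2 (cmod a)))"
    unfolding N sum_subtractf[symmetric]
  proof (rule sum_mono)
    fix a
    have "(if cmod a \<le> x2 then ln x3 - ln x2 else 0) \<le> ln (max x3 (cmod a)) - ln (max x2 (cmod a))"
      using x by (auto simp: max_def intro!: ln_mono)
    from mult_left_mono[OF this, of "real (m a)"]
    show "(if cmod a \<le> x2 then real (m a) * (ln x3 - ln x2) else 0)
      \<le> real (m a) * ln (max x3 (cmod a)) - real (m a) * ln (max x2 (cmod a))"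
      by (auto simp: algebra_simps split: if_splits)
  qed
  then have right: "(real N - \<beta>) * (ln x3 - ln x2) \<le> g x2 - g x3"
    by (simp add: g_def algebra_simps)
  have "1/4 \<le> \<beta> - real N \<or> 1/4 \<le> real N - \<beta>"
    using gap[of "int N"] by (simp add: abs_if split: if_splits)
  then show ?thesis
  proof
    assume "1/4 \<le> \<beta> - real N"
    then have "1/4 * (ln x2 - ln x1) \<le> (\<beta> - real N) * (ln x2 - ln x1)"
      using ln12 by (intro mult_right_mono) auto
    with left show ?thesis by simp
  next
    assume "1/4 \<le> real N - \<beta>"
    then have "1/4 * (ln x3 - ln x2) \<le> (real N - \<beta>) * (ln x3 - ln x2)"
      using ln23 by (intro mult_right_mono) auto
    with right show ?thesis by simp
  qed
qed

section \<open>Growth of the radii and circle means of the potential\<close>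

context
  fixes \<sigma> :: "real \<Rightarrow> real"
  assumes cont: "continuous_on {1..} \<sigma>" and pos: "\<And>t. t \<ge> 1 \<Longrightarrow> \<sigma> t > 0"
begin

lemma integrable_sigma: "1 \<le> a \<Longrightarrow> (\<lambda>t. \<sigma> t / t) integrable_on {a..b}"
  by (intro integrable_continuous_real continuous_intros continuous_on_subset[OF cont]) auto

lemma ln_psi_eq_add:
  assumes "1 \<le> a" "a \<le> b"
  shows "ln (psi \<sigma> b) = ln (psi \<sigma> a) + integral {a..b} (\<lambda>t. \<sigma> t / t)"
  using Henstock_Kurzweil_Integration.integral_combine[OF assms integrable_sigma[of 1 b]]
  by (simp add: psi_def)

lemma ln_psi_mono:
  assumes "1 \<le> a" "a \<le> b"
  shows "ln (psi \<sigma> a) \<le> ln (psi \<sigma> b)"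
proof -
  have "0 \<le> integral {a..b} (\<lambda>t. \<sigma> t / t)"
    using assms pos by (intro integral_nonneg integrable_sigma) (auto intro!: divide_nonneg_nonneg less_imp_le)
  with ln_psi_eq_add[OF assms] show ?thesis by simp
qed

lemma ln_psi_pos:
  assumes "1 < a"
  shows "0 < ln (psi \<sigma> a)"
proof -
  have "0 \<le> ln (psi \<sigma> a)" using ln_psi_mono[of 1 a] assms by (simp add: psi_def)
  moreover have False if "ln (psi \<sigma> a) = 0"
  proof -
    have cont_a: "continuous_on {1..a} (\<lambda>t. \<sigma> t / t)"
      by (intro continuous_intros continuous_on_subset[OF cont]) auto
    have nonneg: "0 \<le> \<sigma> t / t" if "t \<in> {1..a}" for t
      using that pos[of t] by simp
    have "integral {1..a} (\<lambda>t. \<sigma> t / t) = 0" using that by (simp add: psi_def)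
    then have "\<sigma> 1 / 1 = 0"
      using integral_eq_0_iff[OF cont_a assms nonneg] assms by auto
    with pos[of 1] show False by simp
  qed
  ultimately show ?thesis by fastforce
qed

text \<open>
For \<open>a = radius \<sigma> k\<close> and \<open>b\<close> up to the next radius, \<open>ln b - ln a\<close> is itself at most \<open>ln (psi \<sigma> a)\<close>,
so that \<open>ln (psi \<sigma> b)\<close> at most doubles between consecutive radii far out.
\<close>
lemma ln_psi_le_add_ln:
  assumes "1 \<le> a" "a \<le> b" and small: "\<And>t. a \<le> t \<Longrightarrow> \<sigma> t \<le> 1"
  shows "ln (psi \<sigma> b) \<le> ln (psi \<sigma> a) + (ln b - ln a)"
proof -
  have "((\<lambda>t. 1 / t) has_integral (ln b - ln a)) {a..b}"
    using assms by (intro fundamental_theorem_of_calculus)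
      (auto intro!: derivative_eq_intros simp flip: has_real_derivative_iff_has_vector_derivative)
  then have "integral {a..b} (\<lambda>t. \<sigma> t / t) \<le> ln b - ln a"
    using assms by (intro has_integral_le[OF integrable_integral[OF integrable_sigma]])
      (auto intro!: divide_right_mono)
  with ln_psi_eq_add[OF assms(1,2)] show ?thesis by simp
qed

lemma radius_ge_2: "2 \<le> radius \<sigma> k"
proof (induction k)
  case (Suc k)
  then have "1 \<le> psi \<sigma> (radius \<sigma> k)"
    using ln_psi_pos[of "radius \<sigma> k"] by (simp add: psi_def)
  with Suc show ?case using mult_mono[of 2 "radius \<sigma> k" 1 "psi \<sigma> (radius \<sigma> k)"] by simp
qed simp

lemma ln_radius_Suc: "ln (radius \<sigma> (Suc k)) = ln (radius \<sigma> k) + ln (psi \<sigma> (radius \<sigma> k))"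
  using radius_ge_2[of k] by (simp add: ln_mult psi_def)

lemma ln_psi_radius_ge: "ln (psi \<sigma> 2) \<le> ln (psi \<sigma> (radius \<sigma> k))"
  by (rule ln_psi_mono) (use radius_ge_2 in auto)

lemma strict_mono_radius: "strict_mono (radius \<sigma>)"
proof (rule strict_monoI_Suc)
  fix k
  have "ln (radius \<sigma> k) < ln (radius \<sigma> (Suc k))"
    using ln_radius_Suc[of k] ln_psi_pos[of "radius \<sigma> k"] radius_ge_2[of k] by simp
  then show "radius \<sigma> k < radius \<sigma> (Suc k)"
    using radius_ge_2[of k] radius_ge_2[of "Suc k"] by (subst (asm) ln_less_cancel_iff) auto
qed

text \<open>
Geometric growth is all that holds in general: when \<open>\<sigma> t / t\<close> is integrable, \<open>psi \<sigma>\<close> is bounded.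
\<close>
lemma radius_ge_geometric: "psi \<sigma> 2 ^ k \<le> radius \<sigma> k"
proof (induction k)
  case (Suc k)
  have "psi \<sigma> 2 \<le> psi \<sigma> (radius \<sigma> k)"
    using ln_psi_radius_ge[of k] by (simp add: psi_def)
  moreover have "0 \<le> radius \<sigma> k" "0 \<le> psi \<sigma> 2"
    using radius_ge_2[of k] by (simp_all add: psi_def)
  ultimately have "psi \<sigma> 2 ^ k * psi \<sigma> 2 \<le> radius \<sigma> k * psi \<sigma> (radius \<sigma> k)"
    using Suc by (intro mult_mono)
  then show ?case by (simp add: mult.commute)
qed simp

lemma psi_2_gt_1: "1 < psi \<sigma> 2"
  using ln_psi_pos[of 2] by (simp add: psi_def)

lemma radius_at_top: "filterlim (radius \<sigma>) at_top sequentially"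
proof (rule filterlim_at_top_mono)
  show "filterlim (\<lambda>k. norm (psi \<sigma> 2 ^ k)) at_top sequentially"
    using psi_2_gt_1
    by (intro filterlim_at_infinity_imp_norm_at_top filterlim_realpow_sequentially_gt1) simp
  show "\<forall>\<^sub>F k in sequentially. norm (psi \<sigma> 2 ^ k) \<le> radius \<sigma> k"
    using psi_2_gt_1 radius_ge_geometric by simp
qed

lemma summable_inverse_radius: "summable (\<lambda>k. 1 / radius \<sigma> (Suc k))"
proof (rule summable_comparison_test')
  show "summable (\<lambda>k. (1 / psi \<sigma> 2) ^ Suc k)"
    using psi_2_gt_1 by (intro summable_ignore_initial_segment[where k=1, simplified] summable_geometric) auto
  show "norm (1 / radius \<sigma> (Suc k)) \<le> (1 / psi \<sigma> 2) ^ Suc k" for k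
  proof -
    have "1 / radius \<sigma> (Suc k) \<le> 1 / psi \<sigma> 2 ^ Suc k"
      using radius_ge_geometric[of "Suc k"] psi_2_gt_1 radius_ge_2[of "Suc k"]
      by (intro divide_left_mono mult_pos_pos zero_less_power) (simp_all del: radius.simps power_Suc)
    then show ?thesis using radius_ge_2[of "Suc k"] by (simp add: power_one_over del: radius.simps)
  qed
qed

lemma has_circle_mean_u_psi:
  assumes "radius \<sigma> k < cmod z" "cmod z < radius \<sigma> (Suc k)"
  shows "has_circle_mean (u_psi \<sigma>) z
    (real k / 2 * ln (cmod z) - 1/2 * (\<Sum>i<k. ln (radius \<sigma> (Suc i))))"
proof -
  have "has_circle_mean (\<lambda>x. \<Sum>i. ln (cmod (1 - x / of_real (radius \<sigma> (Suc i))))) z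
      (\<Sum>i<k. ln (cmod z) - ln (radius \<sigma> (Suc i)))"
  proof (rule has_circle_mean_log_product)
    show "0 < radius \<sigma> (Suc i)" for i using radius_ge_2[of "Suc i"] by linarith
    show "mono (\<lambda>i. radius \<sigma> (Suc i))"
      using strict_mono_radius by (intro monoI) (simp only: strict_mono_less_eq Suc_le_mono)
    show "radius \<sigma> (Suc i) < cmod z" if "i < k" for i
    proof -
      have "radius \<sigma> (Suc i) \<le> radius \<sigma> k"
        using strict_mono_radius that by (simp only: strict_mono_less_eq Suc_le_eq)
      with assms show ?thesis by linarith
    qed
    show "z \<noteq> 0" using assms(1) radius_ge_2[of k] by auto
  qed (use assms summable_inverse_radius in auto)
  from has_circle_mean_cmult[OF this, of "1/2"] show ?thesis
    by (simp add: u_psi_def[abs_def] sum_subtractf right_diff_distrib del: radius.simps)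
qed

lemma borel_measurable_u_psi [measurable]: "u_psi \<sigma> \<in> borel_measurable borel"
  unfolding u_psi_def[abs_def] by measurable

end

section \<open>Impossibility of the approximation\<close>

theorem theorem2:
  fixes \<sigma> :: "real \<Rightarrow> real"
  assumes "continuous_on {1..} \<sigma>"
    and "\<And>t. t \<ge> 1 \<Longrightarrow> \<sigma> t > 0"
    and "(\<sigma> \<longlongrightarrow> 0) at_top"
  shows "\<not> (\<exists>(f :: complex \<Rightarrow> complex) (\<alpha> :: real).
            f holomorphic_on UNIV \<and> (\<exists>z. f z \<noteq> 0) \<and> 0 \<le> \<alpha> \<and> \<alpha> < 1 \<and>
            (\<forall>\<epsilon>>0. \<forall>\<^sub>F R in at_top.
               deviation \<sigma> f \<alpha> R \<le> ennreal (\<epsilon> * (R\<^sup>2 * ln (psi \<sigma> R)))))"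
proof
  assume "\<exists>(f :: complex \<Rightarrow> complex) (\<alpha> :: real).
            f holomorphic_on UNIV \<and> (\<exists>z. f z \<noteq> 0) \<and> 0 \<le> \<alpha> \<and> \<alpha> < 1 \<and>
            (\<forall>\<epsilon>>0. \<forall>\<^sub>F R in at_top.
               deviation \<sigma> f \<alpha> R \<le> ennreal (\<epsilon> * (R\<^sup>2 * ln (psi \<sigma> R))))"
  then obtain f \<alpha> z0 where f: "f holomorphic_on UNIV" "f z0 \<noteq> 0" and \<alpha>: "0 \<le> \<alpha>" "\<alpha> < 1"
    and small: "\<And>\<epsilon>. \<epsilon> > 0 \<Longrightarrow>
       \<forall>\<^sub>F R in at_top. deviation \<sigma> f \<alpha> R \<le> ennreal (\<epsilon> * (R\<^sup>2 * ln (psi \<sigma> R)))"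
    by blast
  note \<sigma> = assms(1,2)
  \<comment> \<open>The annuli on which small means are sought have logarithmic width \<open>h\<close>,
      an eighth of a lower bound for the width of all gaps between consecutive radii.\<close>
  define h where "h = ln (psi \<sigma> 2) / 8"
  have "h > 0" using ln_psi_pos[OF \<sigma>, of 2] by (simp add: h_def)
  \<comment> \<open>Small enough that \<open>2 * L * \<epsilon>\<close> stays below \<open>L/40\<close> times the area
      factor \<open>pi * (1 - exp (- 2 * h))\<close> of such an annulus.\<close>
  define \<epsilon> where "\<epsilon> = pi * (1 - exp (- 2 * h)) / 100"
  have "\<epsilon> > 0" using \<open>h > 0\<close> by (simp add: \<epsilon>_def)
  from exists_half_integer_far_from_integers[OF \<alpha>] obtain j
    where j: "\<And>n::int. 1/4 \<le> \<bar>real j / 2 - \<alpha> - of_int n\<bar>" by blast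
  have "\<forall>\<^sub>F t in at_top. \<sigma> t < 1"
    using assms(3) by (rule order_tendstoD) simp
  then obtain T where T: "\<And>t. T \<le> t \<Longrightarrow> \<sigma> t < 1" by (auto simp: eventually_at_top_linorder)
  obtain R0 where R0: "\<And>R. R0 \<le> R \<Longrightarrow> deviation \<sigma> f \<alpha> R \<le> ennreal (\<epsilon> * (R\<^sup>2 * ln (psi \<sigma> R)))"
    using small[OF \<open>\<epsilon> > 0\<close>] by (auto simp: eventually_at_top_linorder)
  have "\<forall>\<^sub>F k in sequentially. max T R0 \<le> radius \<sigma> k"
    using radius_at_top[OF \<sigma>] by (simp only: filterlim_at_top)
  then obtain k0 where k0: "\<And>k. k0 \<le> k \<Longrightarrow> max T R0 \<le> radius \<sigma> k"
    unfolding eventually_sequentially by blast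
  \<comment> \<open>Far out, and of the parity for which \<open>k/2 - \<alpha>\<close> avoids the integers.\<close>
  define k where "k = 2 * k0 + j"
  define \<beta> where "\<beta> = real k / 2 - \<alpha>"
  have gap: "1/4 \<le> \<bar>\<beta> - of_int n\<bar>" for n :: int
    using j[of "n - int k0"] by (simp add: \<beta>_def k_def algebra_simps add_divide_distrib)
  define r where "r = radius \<sigma> k"
  define L where "L = ln (psi \<sigma> r)"
  have r: "2 \<le> r" "T \<le> r" "R0 \<le> r"
    using k0[of k] radius_ge_2[OF \<sigma>, of k] by (auto simp: r_def k_def)
  have L: "8 * h \<le> L"
    using ln_psi_radius_ge[OF \<sigma>, of k] by (simp add: h_def L_def r_def)
  have r_next: "radius \<sigma> (Suc k) = r * exp L"
    by (simp add: r_def L_def psi_def)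
  define v where "v = (\<lambda>z. u_psi \<sigma> z - ln (cmod (f z)) - \<alpha> * ln (cmod z))"
  have f_meas [measurable]: "f \<in> borel_measurable borel"
    using f(1) by (intro borel_measurable_continuous_onI holomorphic_on_imp_continuous_on)
  have v_meas: "v \<in> borel_measurable borel"
    unfolding v_def using borel_measurable_u_psi[OF \<sigma>, measurable] by measurable
  from has_circle_mean_ln_entire[OF f, of "r * exp L"] obtain c Z and m :: "complex \<Rightarrow> nat" where
    Z: "finite Z" and mean_f: "\<And>z. z \<noteq> 0 \<Longrightarrow> cmod z < r * exp L \<Longrightarrow> cmod z \<notin> cmod ` Z \<Longrightarrow>
      has_circle_mean (\<lambda>x. ln (cmod (f x))) z (c + (\<Sum>a\<in>Z. real (m a) * ln (max (cmod z) (cmod a))))"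
    by blast
  define g where "g = (\<lambda>x. \<beta> * ln x - (\<Sum>a\<in>Z. real (m a) * ln (max x (cmod a))))"
  define d where "d = - 1/2 * (\<Sum>i<k. ln (radius \<sigma> (Suc i))) - c"
  have mean_v: "has_circle_mean v z (g (cmod z) + d)"
    if z: "r < cmod z" "cmod z < r * exp L" "cmod z \<notin> cmod ` Z" for z
  proof -
    have "z \<noteq> 0" using z(1) r(1) by auto
    have "has_circle_mean v z ((real k / 2 * ln (cmod z) - 1/2 * (\<Sum>i<k. ln (radius \<sigma> (Suc i))))
        - (c + (\<Sum>a\<in>Z. real (m a) * ln (max (cmod z) (cmod a)))) - \<alpha> * ln (cmod z))"
      unfolding v_def
    proof (intro has_circle_mean_diff has_circle_mean_u_psi[OF \<sigma>] mean_f has_circle_mean_cmult)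
      show "has_circle_mean (\<lambda>x. ln (cmod x)) z (ln (cmod z))"
        using has_circle_mean_ln_diff[of z 0] \<open>z \<noteq> 0\<close> by simp
    qed (use z \<open>z \<noteq> 0\<close> in \<open>simp_all add: r_def[symmetric] r_next del: radius.simps\<close>)
    also have "(real k / 2 * ln (cmod z) - 1/2 * (\<Sum>i<k. ln (radius \<sigma> (Suc i))))
        - (c + (\<Sum>a\<in>Z. real (m a) * ln (max (cmod z) (cmod a)))) - \<alpha> * ln (cmod z) = g (cmod z) + d"
      by (simp add: g_def d_def \<beta>_def algebra_simps del: radius.simps)
    finally show ?thesis .
  qed
  \<comment> \<open>Otherwise the mass of \<open>v\<close> on this annulus alone would exceed the assumed bound.\<close>
  have window: "\<exists>x. r * exp (s - h) < x \<and> x < r * exp s \<and> \<bar>g x + d\<bar> < L / 40"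
    if s: "h \<le> s" "s \<le> L" for s
  proof (rule ccontr)
    assume "\<not> ?thesis"
    then have large: "\<And>x. r * exp (s - h) < x \<Longrightarrow> x < r * exp s \<Longrightarrow> L / 40 \<le> \<bar>g x + d\<bar>"
      by (meson not_less)
    define R where "R = r * exp s"
    have "r * 1 \<le> R" unfolding R_def using r s \<open>h > 0\<close> by (intro mult_left_mono) auto
    then have R: "r \<le> R" by simp
    have lower: "r \<le> r * exp (s - h)" using r(1) s by simp
    have upper: "R \<le> r * exp L" using r(1) s by (simp add: R_def)
    have sq: "R\<^sup>2 - (r * exp (s - h))\<^sup>2 = R\<^sup>2 * (1 - exp (- 2 * h))"
    proof -
      have "r * exp (s - h) = R * exp (- h)" by (simp add: R_def exp_diff exp_minus field_simps)
      moreover have "(exp (- h))\<^sup>2 = exp (- 2 * h)" by (simp flip: exp_of_nat_mult)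
      ultimately show ?thesis by (simp add: power_mult_distrib algebra_simps)
    qed
    have "ennreal (L / 40 * (pi * (R\<^sup>2 - (r * exp (s - h))\<^sup>2)))
        \<le> (\<integral>\<^sup>+z\<in>ball 0 R. ennreal \<bar>v z\<bar> \<partial>lborel)"
    proof (rule circle_mean_lower_bound_imp_L1_lower_bound[OF v_meas, where F = "cmod ` Z"])
      show "has_circle_mean v z (g (cmod z) + d)"
        if "r * exp (s - h) < cmod z" "cmod z < R" "cmod z \<notin> cmod ` Z" for z
        using that lower upper by (intro mean_v) auto
      show "r * exp (s - h) < R" using r(1) \<open>h > 0\<close> by (simp add: R_def)
    qed (use large Z r(1) L \<open>h > 0\<close> in \<open>auto simp: R_def\<close>)
    also have "\<dots> = deviation \<sigma> f \<alpha> R" by (simp add: deviation_def v_def)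
    also have "\<dots> \<le> ennreal (\<epsilon> * (R\<^sup>2 * ln (psi \<sigma> R)))"
      using R r by (intro R0) simp
    finally have "L / 40 * (pi * (R\<^sup>2 - (r * exp (s - h))\<^sup>2)) \<le> \<epsilon> * (R\<^sup>2 * ln (psi \<sigma> R))"
      using ln_psi_pos[OF \<sigma>, of R] R r \<open>\<epsilon> > 0\<close> by (subst (asm) ennreal_le_iff) auto
    also have "\<dots> \<le> \<epsilon> * (R\<^sup>2 * (2 * L))"
    proof -
      have "ln (psi \<sigma> R) \<le> L + (ln R - ln r)"
        unfolding L_def using r R T by (intro ln_psi_le_add_ln[OF \<sigma>]) (auto intro: less_imp_le)
      also have "ln R - ln r = s" using r(1) by (simp add: R_def ln_mult)
      finally show ?thesis using s \<open>\<epsilon> > 0\<close> by (intro mult_left_mono) auto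
    qed
    finally have "R\<^sup>2 * L * (1 - exp (- 2 * h)) * pi * (1 / 40 - 1 / 50) \<le> 0"
      unfolding sq \<epsilon>_def by (simp add: algebra_simps)
    moreover have "0 < R\<^sup>2 * L * (1 - exp (- 2 * h)) * pi * (1 / 40 - 1 / 50)"
      using R r(1) L \<open>h > 0\<close> by (intro mult_pos_pos) auto
    ultimately show False by linarith
  qed
  \<comment> \<open>The logarithms of these radii differ by more than \<open>L/2 - 2 * h\<close>, which is at least \<open>L/4\<close>.\<close>
  obtain x1 x2 x3 where
    x1: "r * exp (h - h) < x1" "x1 < r * exp h" "\<bar>g x1 + d\<bar> < L / 40" and
    x2: "r * exp (L/2 - h) < x2" "x2 < r * exp (L/2)" "\<bar>g x2 + d\<bar> < L / 40" and
    x3: "r * exp (L - h) < x3" "x3 < r * exp L" "\<bar>g x3 + d\<bar> < L / 40"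
    using window[of h] window[of "L/2"] window[of L] L \<open>h > 0\<close> by fastforce
  have ln_bounds: "0 < x" "ln r + s < ln x" "ln x < ln r + t"
    if "r * exp s < x" "x < r * exp t" for x s t
  proof -
    have "0 < r * exp s" using r(1) by simp
    with that show "0 < x" by linarith
    have "ln (r * exp s) < ln x" "ln x < ln (r * exp t)"
      using that \<open>0 < r * exp s\<close> \<open>0 < x\<close> r(1) by (auto simp del: ln_exp)
    then show "ln r + s < ln x" "ln x < ln r + t" using r(1) by (simp_all add: ln_mult)
  qed
  note b1 = ln_bounds[OF x1(1,2)] and b2 = ln_bounds[OF x2(1,2)] and b3 = ln_bounds[OF x3(1,2)]
  have "x1 < x2" "x2 < x3"
    using b1 b2 b3 L \<open>h > 0\<close> ln_less_cancel_iff[of x1 x2] ln_less_cancel_iff[of x2 x3] by linarith+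
  from log_drift[OF b1(1) this gap, of m Z]
  have "ln x2 - ln x1 \<le> 4 * (g x2 - g x1) \<or> ln x3 - ln x2 \<le> 4 * (g x2 - g x3)"
    unfolding g_def .
  then consider "ln x2 - ln x1 \<le> 4 * (g x2 - g x1)" | "ln x3 - ln x2 \<le> 4 * (g x2 - g x3)"
    by blast
  moreover have "L / 4 < ln x2 - ln x1" "L / 4 < ln x3 - ln x2"
    using b1 b2 b3 L \<open>h > 0\<close> by linarith+
  moreover have "g x2 - g x1 < L / 20" "g x2 - g x3 < L / 20"
    using x1(3) x2(3) x3(3) by linarith+
  moreover have "0 < L" using L \<open>h > 0\<close> by linarith
  ultimately show False by cases (simp_all add: field_simps)
qed

end
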